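(* Let $\omega'\in\{0,1\}^{\mathbb N}$ be any aperiodic infinite word, and let $\omega$ be the image of $\omega'$ under the morphism $0\mapsto 012$, $1\mapsto 021$. Then $\rho^{\mathrm{ab}}_{\omega}(n)=3$ for all $n\ge 1$.
   Context: A right-infinite word $x=x_0x_1x_2\cdots$ is ultimately periodic if there is $p\ge1$ with $x_{i+p}=x_i$ for all sufficiently large $i$, and aperiodic if it is not ultimately periodic. The image of an infinite word under a morphism is obtained by replacing each letter by its image and concatenating. A factor of an infinite word is a finite block of consecutive letters of it. Two finite words are Abelian equivalent if every letter occurs the same number of times in both; $\rho^{\mathrm{ab}}_{\omega}(n)$ is the number of Abelian equivalence classes of factors of $\omega$ of length $n$. *)

theory Defs
  imports Main "HOL-Library.Stream"
begin

text \<open>Right-infinite words are streams, finite words are lists.\<close>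

definition ultimately_periodic :: "'a stream \<Rightarrow> bool" where
  "ultimately_periodic x \<longleftrightarrow> (\<exists>p\<ge>1. \<exists>N. \<forall>i\<ge>N. x !! (i + p) = x !! i)"

definition aperiodic :: "'a stream \<Rightarrow> bool" where
  "aperiodic x \<longleftrightarrow> \<not> ultimately_periodic x"

text \<open>
  A morphism is given by its values on letters. The concatenation \<open>flat\<close> is meaningful only if
  no letter of the word is mapped to the empty list.
\<close>

definition morphic_image :: "('a \<Rightarrow> 'b list) \<Rightarrow> 'a stream \<Rightarrow> 'b stream" where
  "morphic_image h x = flat (smap h x)"

definition factors :: "'a stream \<Rightarrow> nat \<Rightarrow> 'a list set" where
  "factors x n = {stake n (sdrop i x) | i. True}"

definition abelian_equiv :: "'a list \<Rightarrow> 'a list \<Rightarrow> bool" where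
  "abelian_equiv u v \<longleftrightarrow> (\<forall>a. count_list u a = count_list v a)"

definition abelian_complexity :: "'a stream \<Rightarrow> nat \<Rightarrow> nat" where
  "abelian_complexity x n =
     card (factors x n // {(u, v). u \<in> factors x n \<and> v \<in> factors x n \<and> abelian_equiv u v})"

text \<open>Only the values at the letters 0 and 1 matter.\<close>

definition phi :: "nat \<Rightarrow> nat list" where
  "phi a = (if a = 0 then [0, 1, 2] else [0, 2, 1])"

end

theory Submission
  imports Defs
begin

text \<open>
  Every block \<open>012\<close> or \<open>021\<close> contains each letter exactly once, so only the incomplete blocks at
  the two ends of a factor influence how its letter counts deviate from equality, and they can do
  so in few ways. Write \<open>w\<close> for the binary word, \<open>b k\<close> for the middle letter of its \<open>k\<close>-th block
  (\<open>1\<close> if \<open>w k = 0\<close>, and \<open>2\<close> if \<open>w k = 1\<close>), and let \<open>m\<close> be the quotient of the length by 3.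

  If the length is \<open>3m + 1\<close>, a factor consists, up to order, of \<open>m\<close> copies of each letter and one
  more letter, which can be \<open>0\<close>, or \<open>1\<close> or \<open>2\<close> because both values occur in \<open>w\<close> at arbitrarily
  large indices. If it is \<open>3m + 2\<close>, one letter is missing instead. If it is \<open>3m\<close>, the counts are
  all equal unless the factor starts at the last letter of block \<open>k\<close>; then it ends at the middle
  letter of block \<open>k + m\<close>, and relative to the equal counts it has lost the letter \<open>b k\<close> and gained
  \<open>b (k + m)\<close>. So there are three classes exactly if both a rise \<open>w k < w (k + m)\<close> and a fall
  \<open>w k > w (k + m)\<close> occur.

  This is where aperiodicity enters. If there were no rise, then the window sums
  \<open>w k + \<dots> + w (k + m - 1)\<close> would be nonincreasing in \<open>k\<close>, hence eventually constant, which says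
  \<open>w k = w (k + m)\<close> for all large \<open>k\<close>. Exchanging the two letters gives the same for falls
  (lemmas \<open>eventually_periodic_if_no_rise\<close> and \<open>aperiodic_binary_rise_and_fall\<close>).
\<close>

section \<open>Rises and falls at a fixed distance\<close>

text \<open>
  The sum of \<open>f\<close> over a window of length \<open>m\<close> changes by \<open>f (k + m) - f k \<le> 0\<close> when the window
  moves one step. From a point where this sum is minimal on, it is therefore constant.
\<close>

lemma eventually_periodic_if_no_rise:
  fixes f :: "nat \<Rightarrow> nat"
  assumes no_rise: "\<And>k. f (k + m) \<le> f k"
  shows "\<exists>N. \<forall>i\<ge>N. f (i + m) = f i"
proof -
  define S where "S k = (\<Sum>j<m. f (k + j))" for k
  have step: "S (Suc k) + f k = S k + f (k + m)" for k
  proof -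
    have "S (Suc k) + f k = (\<Sum>j<Suc m. f (k + j))"
      unfolding S_def by (subst sum.lessThan_Suc_shift) simp
    then show ?thesis
      by (simp add: S_def)
  qed
  obtain N where least: "\<And>k. S N \<le> S k"
    using ex_has_least_nat[of "\<lambda>_. True" 0 S] by auto
  have "S (Suc k) \<le> S k" for k
    using step[of k] no_rise[of k] by linarith
  then have "S k \<le> S N" if "N \<le> k" for k
    using that lift_Suc_antimono_le by blast
  then have const: "S k = S N" if "N \<le> k" for k
    using that least[of k] by (simp add: le_antisym)
  have "f (i + m) = f i" if "N \<le> i" for i
    using step[of i] const[of i] const[of "Suc i"] that by simp
  then show ?thesis
    by blast
qed

lemma aperiodic_binary_rise_and_fall:
  fixes w :: "nat stream"
  assumes binary: "sset w \<subseteq> {0, 1}" and "aperiodic w" and "m \<ge> 1"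
  obtains k l where "w !! k = 0" "w !! (k + m) = 1" "w !! l = 1" "w !! (l + m) = 0"
proof -
  have letter: "w !! i = 0 \<or> w !! i = 1" for i
    using binary snth_sset[of w i] by blast
  have not_periodic: "\<not> (\<exists>N. \<forall>i\<ge>N. w !! (i + m) = w !! i)"
    using assms(2,3) unfolding aperiodic_def ultimately_periodic_def by blast
  have "\<exists>k. \<not> w !! (k + m) \<le> w !! k"
    using eventually_periodic_if_no_rise[of "\<lambda>i. w !! i" m] not_periodic by blast
  then obtain k where "\<not> w !! (k + m) \<le> w !! k" ..
  then have k: "w !! k = 0" "w !! (k + m) = 1"
    using letter[of k] letter[of "k + m"] by auto
  have "\<exists>l. \<not> 1 - w !! (l + m) \<le> 1 - w !! l"
  proof (rule ccontr)
    assume "\<not> ?thesis"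
    then obtain N where N: "\<And>i. i \<ge> N \<Longrightarrow> 1 - w !! (i + m) = 1 - w !! i"
      using eventually_periodic_if_no_rise[of "\<lambda>i. 1 - w !! i" m] by blast
    have "w !! (i + m) = w !! i" if "i \<ge> N" for i
      using N[OF that] letter[of i] letter[of "i + m"] by auto
    then show False
      using not_periodic by blast
  qed
  then obtain l where "\<not> 1 - w !! (l + m) \<le> 1 - w !! l" ..
  then have "w !! l = 1" "w !! (l + m) = 0"
    using letter[of l] letter[of "l + m"] by auto
  with k show thesis
    by (rule that)
qed

section \<open>Abelian complexity as a number of counting functions\<close>

lemma card_quotient_kernel:
  "card (A // {(u, v). u \<in> A \<and> v \<in> A \<and> f u = f v}) = card (f ` A)"
proof -
  let ?class = "\<lambda>y. {v \<in> A. y = f v}"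
  have "A // {(u, v). u \<in> A \<and> v \<in> A \<and> f u = f v} = ?class ` f ` A"
    unfolding quotient_def by fastforce
  moreover have "inj_on ?class (f ` A)"
    by (rule inj_onI) blast
  ultimately show ?thesis
    by (simp add: card_image)
qed

lemma abelian_complexity_eq_card_counts:
  "abelian_complexity x n = card (range (\<lambda>i. count_list (stake n (sdrop i x))))"
proof -
  have "abelian_equiv u v \<longleftrightarrow> count_list u = count_list v" for u v :: "'a list"
    by (auto simp: abelian_equiv_def)
  moreover have "count_list ` factors x n = range (\<lambda>i. count_list (stake n (sdrop i x)))"
    by (auto simp: factors_def)
  ultimately show ?thesis
    by (simp add: abelian_complexity_def card_quotient_kernel)
qed

lemma count_list_factor:
  "count_list (stake n (sdrop i x)) a = count_list (stake (i + n) x) a - count_list (stake i x) a"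
  by (simp flip: stake_add)

section \<open>Letter counts in the image word\<close>

definition ternary_counts :: "nat \<Rightarrow> nat \<Rightarrow> nat \<Rightarrow> nat \<Rightarrow> nat" where
  "ternary_counts p q r a = (if a = 0 then p else if a = 1 then q else if a = 2 then r else 0)"

lemma ternary_counts_eq_iff:
  "ternary_counts p q r = ternary_counts p' q' r' \<longleftrightarrow> p = p' \<and> q = q' \<and> r = r'"
proof
  assume eq: "ternary_counts p q r = ternary_counts p' q' r'"
  show "p = p' \<and> q = q' \<and> r = r'"
    using fun_cong[OF eq, of 0] fun_cong[OF eq, of 1] fun_cong[OF eq, of 2]
    by (simp add: ternary_counts_def)
qed simp

lemma ternary_counts_diff:
  "ternary_counts p q r a - ternary_counts p' q' r' a = ternary_counts (p - p') (q - q') (r - r') a"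
  by (simp add: ternary_counts_def)

lemma morphic_image_phi_unfold:
  "morphic_image phi w = phi (shd w) @- morphic_image phi (stl w)"
  unfolding morphic_image_def by (subst flat_unfold) (auto simp: phi_def)

lemma count_list_skip_blocks:
  "count_list (stake (3 * k + j) (morphic_image phi w)) a =
     ternary_counts k k k a + count_list (stake j (morphic_image phi (sdrop k w))) a"
proof (induction k arbitrary: w)
  case 0
  then show ?case by (simp add: ternary_counts_def)
next
  case (Suc k)
  have "stake (3 * Suc k + j) (morphic_image phi w) =
      phi (shd w) @ stake (3 * k + j) (morphic_image phi (stl w))"
    by (subst morphic_image_phi_unfold) (simp add: phi_def numeral_3_eq_3)
  then show ?case
    by (simp add: Suc.IH) (simp add: phi_def ternary_counts_def)
qed

lemma count_list_prefix:
  "count_list (stake (3 * k) (morphic_image phi w)) = ternary_counts k k k"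
  "count_list (stake (3 * k + 1) (morphic_image phi w)) = ternary_counts (k + 1) k k"
  "count_list (stake (3 * k + 2) (morphic_image phi w)) =
     (if w !! k = 0 then ternary_counts (k + 1) (k + 1) k else ternary_counts (k + 1) k (k + 1))"
proof -
  have start: "stake 1 (morphic_image phi y) = [0]"
    "stake 2 (morphic_image phi y) = [0, if shd y = 0 then 1 else 2]" for y
    by (subst morphic_image_phi_unfold, simp add: phi_def numeral_2_eq_2)+
  show "count_list (stake (3 * k) (morphic_image phi w)) = ternary_counts k k k"
    using count_list_skip_blocks[of k 0 w] by auto
  show "count_list (stake (3 * k + 1) (morphic_image phi w)) = ternary_counts (k + 1) k k"
    by (rule ext) (simp only: count_list_skip_blocks start, simp add: ternary_counts_def)
  show "count_list (stake (3 * k + 2) (morphic_image phi w)) =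
     (if w !! k = 0 then ternary_counts (k + 1) (k + 1) k else ternary_counts (k + 1) k (k + 1))"
    by (rule ext) (simp only: count_list_skip_blocks start, simp add: ternary_counts_def)
qed

text \<open>
  For each length modulo 3, the three equations treat the starting positions \<open>3k\<close>, \<open>3k + 1\<close> and
  \<open>3k + 2\<close>. The end position is rewritten in the form \<open>3k' + j\<close> so that the factor is a difference of
  two prefixes whose counts are known.
\<close>

lemma factor_counts_length_0:
  fixes w :: "nat stream" and m k :: nat
  defines "F \<equiv> \<lambda>i. count_list (stake (3 * m) (sdrop i (morphic_image phi w)))"
  shows "F (3 * k) = ternary_counts m m m"
    and "F (3 * k + 1) = ternary_counts m m m"
    and "F (3 * k + 2) =
      (if (w !! k = 0) = (w !! (k + m) = 0) then ternary_counts m m m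
       else if w !! k = 0 then ternary_counts m (m - 1) (m + 1)
       else ternary_counts m (m + 1) (m - 1))"
proof -
  have ends: "3 * k + 3 * m = 3 * (k + m)" "3 * k + 1 + 3 * m = 3 * (k + m) + 1"
    "3 * k + 2 + 3 * m = 3 * (k + m) + 2"
    by simp_all
  show "F (3 * k) = ternary_counts m m m"
    unfolding F_def
    by (rule ext) (simp only: count_list_factor ends count_list_prefix ternary_counts_diff, simp)
  show "F (3 * k + 1) = ternary_counts m m m"
    unfolding F_def
    by (rule ext) (simp only: count_list_factor ends count_list_prefix ternary_counts_diff, simp)
  show "F (3 * k + 2) =
      (if (w !! k = 0) = (w !! (k + m) = 0) then ternary_counts m m m
       else if w !! k = 0 then ternary_counts m (m - 1) (m + 1)
       else ternary_counts m (m + 1) (m - 1))"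
    unfolding F_def
    by (rule ext) (simp only: count_list_factor ends count_list_prefix, simp add: ternary_counts_diff)
qed

lemma factor_counts_length_1:
  fixes w :: "nat stream" and m k :: nat
  defines "F \<equiv> \<lambda>i. count_list (stake (3 * m + 1) (sdrop i (morphic_image phi w)))"
  shows "F (3 * k) = ternary_counts (m + 1) m m"
    and "F (3 * k + 1) =
      (if w !! (k + m) = 0 then ternary_counts m (m + 1) m else ternary_counts m m (m + 1))"
    and "F (3 * k + 2) =
      (if w !! k = 0 then ternary_counts m m (m + 1) else ternary_counts m (m + 1) m)"
proof -
  have ends: "3 * k + (3 * m + 1) = 3 * (k + m) + 1" "3 * k + 1 + (3 * m + 1) = 3 * (k + m) + 2"
    "3 * k + 2 + (3 * m + 1) = 3 * (k + m + 1)"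
    by simp_all
  show "F (3 * k) = ternary_counts (m + 1) m m"
    unfolding F_def
    by (rule ext) (simp only: count_list_factor ends count_list_prefix ternary_counts_diff, simp)
  show "F (3 * k + 1) =
      (if w !! (k + m) = 0 then ternary_counts m (m + 1) m else ternary_counts m m (m + 1))"
    unfolding F_def
    by (rule ext) (simp only: count_list_factor ends count_list_prefix, simp add: ternary_counts_diff)
  show "F (3 * k + 2) =
      (if w !! k = 0 then ternary_counts m m (m + 1) else ternary_counts m (m + 1) m)"
    unfolding F_def
    by (rule ext) (simp only: count_list_factor ends count_list_prefix, simp add: ternary_counts_diff)
qed

lemma factor_counts_length_2:
  fixes w :: "nat stream" and m k :: nat
  defines "F \<equiv> \<lambda>i. count_list (stake (3 * m + 2) (sdrop i (morphic_image phi w)))"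
  shows "F (3 * k) =
      (if w !! (k + m) = 0 then ternary_counts (m + 1) (m + 1) m
       else ternary_counts (m + 1) m (m + 1))"
    and "F (3 * k + 1) = ternary_counts m (m + 1) (m + 1)"
    and "F (3 * k + 2) =
      (if w !! k = 0 then ternary_counts (m + 1) m (m + 1)
       else ternary_counts (m + 1) (m + 1) m)"
proof -
  have ends: "3 * k + (3 * m + 2) = 3 * (k + m) + 2" "3 * k + 1 + (3 * m + 2) = 3 * (k + m + 1)"
    "3 * k + 2 + (3 * m + 2) = 3 * (k + m + 1) + 1"
    by simp_all
  show "F (3 * k) =
      (if w !! (k + m) = 0 then ternary_counts (m + 1) (m + 1) m
       else ternary_counts (m + 1) m (m + 1))"
    unfolding F_def
    by (rule ext) (simp only: count_list_factor ends count_list_prefix, simp add: ternary_counts_diff)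
  show "F (3 * k + 1) = ternary_counts m (m + 1) (m + 1)"
    unfolding F_def
    by (rule ext) (simp only: count_list_factor ends count_list_prefix ternary_counts_diff, simp)
  show "F (3 * k + 2) =
      (if w !! k = 0 then ternary_counts (m + 1) m (m + 1)
       else ternary_counts (m + 1) (m + 1) m)"
    unfolding F_def
    by (rule ext) (simp only: count_list_factor ends count_list_prefix, simp add: ternary_counts_diff)
qed

section \<open>Exactly three classes for every length\<close>

lemma mod_3_cases:
  fixes i :: nat
  obtains k where "i = 3 * k" | k where "i = 3 * k + 1" | k where "i = 3 * k + 2"
proof -
  have "i = 3 * (i div 3) \<or> i = 3 * (i div 3) + 1 \<or> i = 3 * (i div 3) + 2"
    by presburger
  then show thesis
    using that by blast
qed

lemma range_eq_mod_3:
  fixes F :: "nat \<Rightarrow> 'a"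
  assumes "\<And>k. F (3 * k) \<in> X" "\<And>k. F (3 * k + 1) \<in> X" "\<And>k. F (3 * k + 2) \<in> X"
    and "X \<subseteq> range F"
  shows "range F = X"
proof -
  have "F i \<in> X" for i
    by (rule mod_3_cases[of i]) (use assms(1-3) in auto)
  with assms(4) show ?thesis
    by blast
qed

theorem theorem7:
  fixes \<omega>' \<omega> :: "nat stream"
  assumes "sset \<omega>' \<subseteq> {0, 1}"
    and "aperiodic \<omega>'"
    and "\<omega> = morphic_image phi \<omega>'"
  shows "\<forall>n\<ge>1. abelian_complexity \<omega> n = 3"
proof (intro allI impI)
  fix n :: nat
  assume "n \<ge> 1"
  let ?F = "\<lambda>i. count_list (stake n (sdrop i \<omega>))"
  have three: "abelian_complexity \<omega> n = 3"
    if "range ?F = {x, y, z}" "x \<noteq> y" "x \<noteq> z" "y \<noteq> z" for x y z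
    using that by (simp add: abelian_complexity_eq_card_counts)
  have late_letters: "\<exists>k. \<omega>' !! (k + m) = 0" "\<exists>k. \<omega>' !! (k + m) \<noteq> 0" for m
  proof -
    \<comment> \<open>The distance \<open>Suc m\<close> is positive even for \<open>m = 0\<close>.\<close>
    obtain k l where "\<omega>' !! (k + Suc m) = 1" "\<omega>' !! (l + Suc m) = 0"
      using aperiodic_binary_rise_and_fall[OF assms(1,2), of "Suc m"] by (metis le_add1 plus_1_eq_Suc)
    then have "\<omega>' !! (Suc l + m) = 0" "\<omega>' !! (Suc k + m) \<noteq> 0"
      by simp_all
    then show "\<exists>k. \<omega>' !! (k + m) = 0" "\<exists>k. \<omega>' !! (k + m) \<noteq> 0"
      by blast+
  qed
  show "abelian_complexity \<omega> n = 3"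
  proof (cases n rule: mod_3_cases)
    case (1 m)
    with \<open>n \<ge> 1\<close> have "m \<ge> 1"
      by simp
    obtain k l where kl: "\<omega>' !! k = 0" "\<omega>' !! (k + m) = 1" "\<omega>' !! l = 1" "\<omega>' !! (l + m) = 0"
      using aperiodic_binary_rise_and_fall[OF assms(1,2) \<open>m \<ge> 1\<close>] by metis
    note F = factor_counts_length_0[of m _ \<omega>', folded 1 assms(3)]
    have "?F (3 * 0) = ternary_counts m m m"
      "?F (3 * k + 2) = ternary_counts m (m - 1) (m + 1)"
      "?F (3 * l + 2) = ternary_counts m (m + 1) (m - 1)"
      by (simp_all only: F kl) simp_all
    then have "{ternary_counts m m m, ternary_counts m (m - 1) (m + 1),
        ternary_counts m (m + 1) (m - 1)} \<subseteq> range ?F"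
      by (metis empty_subsetI insert_subset rangeI)
    then have "range ?F = {ternary_counts m m m, ternary_counts m (m - 1) (m + 1),
        ternary_counts m (m + 1) (m - 1)}"
      by (intro range_eq_mod_3) (simp_all only: F, simp_all)
    then show ?thesis
      by (rule three) (use \<open>m \<ge> 1\<close> in \<open>simp_all add: ternary_counts_eq_iff\<close>)
  next
    case (2 m)
    obtain k l where kl: "\<omega>' !! (k + m) = 0" "\<omega>' !! (l + m) \<noteq> 0"
      using late_letters[of m] by blast
    note F = factor_counts_length_1[of m _ \<omega>', folded 2 assms(3)]
    have "?F (3 * 0) = ternary_counts (m + 1) m m"
      "?F (3 * k + 1) = ternary_counts m (m + 1) m"
      "?F (3 * l + 1) = ternary_counts m m (m + 1)"
      by (simp_all only: F kl) simp_all
    then have "{ternary_counts (m + 1) m m, ternary_counts m (m + 1) m,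
        ternary_counts m m (m + 1)} \<subseteq> range ?F"
      by (metis empty_subsetI insert_subset rangeI)
    then have "range ?F = {ternary_counts (m + 1) m m, ternary_counts m (m + 1) m,
        ternary_counts m m (m + 1)}"
      by (intro range_eq_mod_3) (simp_all only: F, simp_all)
    then show ?thesis
      by (rule three) (simp_all add: ternary_counts_eq_iff)
  next
    case (3 m)
    obtain k l where kl: "\<omega>' !! (k + m) = 0" "\<omega>' !! (l + m) \<noteq> 0"
      using late_letters[of m] by blast
    note F = factor_counts_length_2[of m _ \<omega>', folded 3 assms(3)]
    have "?F (3 * 0 + 1) = ternary_counts m (m + 1) (m + 1)"
      "?F (3 * l) = ternary_counts (m + 1) m (m + 1)"
      "?F (3 * k) = ternary_counts (m + 1) (m + 1) m"
      by (simp_all only: F kl) simp_all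
    then have "{ternary_counts m (m + 1) (m + 1), ternary_counts (m + 1) m (m + 1),
        ternary_counts (m + 1) (m + 1) m} \<subseteq> range ?F"
      by (metis empty_subsetI insert_subset rangeI)
    then have "range ?F = {ternary_counts m (m + 1) (m + 1), ternary_counts (m + 1) m (m + 1),
        ternary_counts (m + 1) (m + 1) m}"
      by (intro range_eq_mod_3) (simp_all only: F, simp_all)
    then show ?thesis
      by (rule three) (simp_all add: ternary_counts_eq_iff)
  qed
qed

end
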